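(* Let $G'$ and $G''$ be simple connected graphs on $[n]$ such that their Laplacian simplices $\mathcal{P}_{G'}$ and $\mathcal{P}_{G''}$ are reflexive. Then the Laplacian simplex $\mathcal{P}_{\mathcal{B}(G',G'')}$ of the bridge $\mathcal{B}(G',G'')$ is reflexive.
   Context: The bridge $\mathcal{B}(G',G'')$ of two graphs (with disjoint copies of their vertex sets) is the graph with vertex set $V(G')\cup V(G'')$ and edge set $E(G')\cup E(G'')\cup\{\{i,j\}\}$ for some $i\in V(G')$ and $j\in V(G'')$. The Laplacian matrix $L$ of a simple graph on $[m]$ has $L_{ii}=\deg(i)$, $L_{ij}=-1$ if $\{i,j\}$ is an edge and $0$ otherwise; the Laplacian simplex is the convex hull in $\mathbb{R}^{m-1}$ of the rows of $L$ with its $m$-th column deleted. A lattice polytope is reflexive if it contains the origin in its interior and its dual $\{\mathbf{x}\mid\mathbf{x}\mathbf{y}^T\le1\ \forall\mathbf{y}\in\mathcal{P}\}$ is a lattice polytope. *)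

theory Defs
  imports "HOL-Analysis.Analysis" "HOL-Library.Function_Algebras"
begin

text \<open>
  Vectors of variable dimension are elements of \<^term>\<open>topspace (Euclidean_space d)\<close>, i.e.
  functions \<^typ>\<open>nat \<Rightarrow> real\<close> vanishing at all indices \<open>\<ge> d\<close>. The pointwise vector space
  structure on functions makes \<open>convex hull\<close> applicable to sets of such vectors.
\<close>

instantiation "fun" :: (type, real_vector) real_vector
begin

definition scaleR_fun :: "real \<Rightarrow> ('a \<Rightarrow> 'b) \<Rightarrow> 'a \<Rightarrow> 'b" where
  "scaleR_fun r f = (\<lambda>x. r *\<^sub>R f x)"

instance
  by standard (auto simp: scaleR_fun_def fun_eq_iff scaleR_add_right scaleR_add_left)

end

definition lattice_polytope :: "nat \<Rightarrow> (nat \<Rightarrow> real) set \<Rightarrow> bool" where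
  "lattice_polytope d P \<longleftrightarrow>
     (\<exists>S. finite S \<and> S \<subseteq> topspace (Euclidean_space d) \<and>
          (\<forall>x\<in>S. \<forall>i. x i \<in> \<int>) \<and> P = convex hull S)"

definition dual_polytope :: "nat \<Rightarrow> (nat \<Rightarrow> real) set \<Rightarrow> (nat \<Rightarrow> real) set" where
  "dual_polytope d P =
     {x \<in> topspace (Euclidean_space d). \<forall>y\<in>P. (\<Sum>k<d. x k * y k) \<le> 1}"

definition reflexive_polytope :: "nat \<Rightarrow> (nat \<Rightarrow> real) set \<Rightarrow> bool" where
  "reflexive_polytope d P \<longleftrightarrow>
     lattice_polytope d P \<and> 0 \<in> (Euclidean_space d) interior_of P \<and>
     lattice_polytope d (dual_polytope d P)"

definition simple_graph :: "'a set \<Rightarrow> 'a set set \<Rightarrow> bool" where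
  "simple_graph V E \<longleftrightarrow> finite V \<and> (\<forall>e\<in>E. e \<subseteq> V \<and> card e = 2)"

definition connected_graph :: "'a set \<Rightarrow> 'a set set \<Rightarrow> bool" where
  "connected_graph V E \<longleftrightarrow>
     V \<noteq> {} \<and> (\<forall>u\<in>V. \<forall>v\<in>V. (u, v) \<in> {(x, y). {x, y} \<in> E}\<^sup>*)"

definition laplacian :: "'a set set \<Rightarrow> 'a \<Rightarrow> 'a \<Rightarrow> int" where
  "laplacian E i j =
     (if i = j then int (card {e \<in> E. i \<in> e}) else if {i, j} \<in> E then -1 else 0)"

text \<open>
  Graphs on \<open>[m]\<close> have vertex set \<^term>\<open>{..<m}\<close>: vertices, rows and columns are numbered from
  \<open>0\<close>, so that the deleted last column has index \<open>m - 1\<close>.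
\<close>

definition laplacian_simplex :: "nat \<Rightarrow> nat set set \<Rightarrow> (nat \<Rightarrow> real) set" where
  "laplacian_simplex m E =
     convex hull ((\<lambda>i k. if k < m - 1 then real_of_int (laplacian E i k) else 0) ` {..<m})"

text \<open>
  The bridge lives on the disjoint union \<open>V' <+> V''\<close>; \<open>i\<close> and \<open>j\<close> are the vertices joined by
  the new edge.
\<close>

definition bridge :: "'a set set \<Rightarrow> 'b set set \<Rightarrow> 'a \<Rightarrow> 'b \<Rightarrow> ('a + 'b) set set" where
  "bridge E' E'' i j = image Inl ` E' \<union> image Inr ` E'' \<union> {{Inl i, Inr j}}"

text \<open>
  The Laplacian simplex of a graph requires its vertices to be numbered; \<open>relabel h E\<close> is the
  edge set transported along a numbering \<open>h\<close>.
\<close>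

definition relabel :: "('a \<Rightarrow> 'b) \<Rightarrow> 'a set set \<Rightarrow> 'b set set" where
  "relabel h E = image h ` E"

end

theory Submission
  imports Defs
begin

text \<open>
  Let \<open>L\<close> be the Laplacian of a connected graph on \<open>m\<close> vertices. The kernel of \<open>L\<close> consists of the
  constants and its image of the vectors with sum \<open>0\<close>. The facet of the Laplacian simplex opposite to
  its \<open>a\<close>-th vertex lies on \<open>x \<bullet> y = 1\<close>, where \<open>L x = 1 - m e\<^sub>a\<close> and the last entry of \<open>x\<close> is \<open>0\<close>. So the
  simplex is reflexive iff \<open>L x = 1 - m e\<^sub>a\<close> has an integral solution for every \<open>a\<close>: adding a
  constant to \<open>x\<close> makes its last entry \<open>0\<close>. This criterion does not depend on the
  numbering of the vertices.

  For the bridge of two graphs on \<open>n\<close> vertices and \<open>a\<close> in the first one, let \<open>p\<close>, \<open>q\<close> be solutions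
  for \<open>a\<close>, \<open>i\<close> on the first graph and \<open>r\<close> one for \<open>j\<close> on the second. Then \<open>2 p - q\<close>, together with
  the translate of \<open>r\<close> that exceeds it by \<open>n\<close> across the new edge, is a solution on the bridge.
\<close>

section \<open>Linear maps on functions of finite support\<close>

lemma sum_fun_apply: "(\<Sum>a\<in>A. f a) x = (\<Sum>a\<in>A. f a x)"
  for f :: "'b \<Rightarrow> 'a \<Rightarrow> 'c::comm_monoid_add"
  by (induction A rule: infinite_finite_induct) auto

text \<open>Dimension count inside a finitely generated subspace of a possibly infinite-dimensional
  space: the image of a basis \<open>C\<close> is independent of the same size, so a vector outside
  its span would yield too many independent vectors.\<close>

lemma linear_inj_on_finite_span_surj:
  fixes T :: "'a::real_vector \<Rightarrow> 'a"
  assumes "linear T" "finite B" "inj_on T (span B)" "T ` span B \<subseteq> span B"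
  shows "T ` span B = span B"
proof
  obtain C where C: "C \<subseteq> span B" "independent C" "span B \<subseteq> span C"
    using maximal_independent_subset by blast
  have fin: "finite C"
    using independent_span_bound[OF assms(2) C(2,1)] by simp
  have eq: "span C = span B"
    using C span_minimal[OF C(1) subspace_span] by blast
  have ind: "independent (T ` C)"
    using linear_independent_injective_image[OF assms(1) C(2)] assms(3) eq by simp
  have card: "card (T ` C) = card C"
    using C(1) assms(3) by (meson card_image inj_on_subset)
  have "v \<in> span (T ` C)" if "v \<in> span B" for v
  proof (rule ccontr)
    assume v: "v \<notin> span (T ` C)"
    then have "independent (insert v (T ` C))"
      using ind by (simp add: independent_insertI)
    moreover have "insert v (T ` C) \<subseteq> span C"
      using that eq C(1) assms(4) by auto
    ultimately have "card (insert v (T ` C)) \<le> card C"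
      using independent_span_bound[OF fin] by blast
    moreover have "v \<notin> T ` C"
      using v span_base[of v "T ` C"] by auto
    ultimately show False
      using fin card by simp
  qed
  then show "span B \<subseteq> T ` span B"
    using linear_span_image[OF assms(1), of C] eq by auto
qed (fact assms(4))

lemma span_deltas:
  assumes "finite V"
  shows "span ((\<lambda>a b. if b = a then 1 else 0) ` V) = {x :: 'a \<Rightarrow> real. \<forall>a. a \<notin> V \<longrightarrow> x a = 0}"
    (is "span ?B = ?S")
proof
  have "subspace ?S"
    by (auto simp: subspace_def scaleR_fun_def)
  moreover have "?B \<subseteq> ?S"
    by auto
  ultimately show "span ?B \<subseteq> ?S"
    by (simp add: span_minimal)
  show "?S \<subseteq> span ?B"
  proof
    fix x :: "'a \<Rightarrow> real"
    assume x: "x \<in> ?S"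
    have "x = (\<Sum>a\<in>V. x a *\<^sub>R (\<lambda>b. if b = a then 1 else 0))"
      using assms x by (auto simp: fun_eq_iff sum_fun_apply scaleR_fun_def if_distrib cong: if_cong)
    moreover have "\<dots> \<in> span ?B"
      by (intro span_sum span_scale span_base) auto
    ultimately show "x \<in> span ?B"
      by simp
  qed
qed

section \<open>The Laplacian operator\<close>

text \<open>One operator serves real and integral potentials; the order on the ring is there for the
  maximum principle.\<close>

definition laplacian_apply :: "'a set \<Rightarrow> 'a set set \<Rightarrow> ('a \<Rightarrow> 'r::linordered_idom) \<Rightarrow> 'a \<Rightarrow> 'r" where
  "laplacian_apply V E x b = (\<Sum>c\<in>V. of_int (laplacian E b c) * x c)"

lemma laplacian_sym: "laplacian E b c = laplacian E c b"
  by (auto simp: laplacian_def insert_commute)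

lemma laplacian_apply_of_int:
  "laplacian_apply V E (\<lambda>c. of_int (x c)) b = of_int (laplacian_apply V E x b)"
  by (simp add: laplacian_apply_def)

lemma simple_graph_edge_subset: "simple_graph V E \<Longrightarrow> {b, c} \<in> E \<Longrightarrow> b \<in> V \<and> c \<in> V \<and> b \<noteq> c"
  unfolding simple_graph_def by (cases "b = c") fastforce+

lemma degree_eq_card_neighbours:
  assumes "simple_graph V E"
  shows "card {e \<in> E. b \<in> e} = card {c \<in> V. {b, c} \<in> E}"
proof -
  have "bij_betw (\<lambda>c. {b, c}) {c \<in> V. {b, c} \<in> E} {e \<in> E. b \<in> e}"
  proof (rule bij_betw_imageI)
    show "inj_on (\<lambda>c. {b, c}) {c \<in> V. {b, c} \<in> E}"
      by (auto simp: inj_on_def doubleton_eq_iff)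
    have "e \<in> (\<lambda>c. {b, c}) ` {c \<in> V. {b, c} \<in> E}" if e: "e \<in> E" "b \<in> e" for e
    proof -
      have "card e = 2"
        using assms e by (auto simp: simple_graph_def)
      then obtain c where c: "e = {b, c}"
        using e(2) by (auto simp: card_2_iff)
      then show ?thesis
        using simple_graph_edge_subset[OF assms, of b c] e(1) by blast
    qed
    then show "(\<lambda>c. {b, c}) ` {c \<in> V. {b, c} \<in> E} = {e \<in> E. b \<in> e}"
      by auto
  qed
  then show ?thesis
    by (simp add: bij_betw_same_card)
qed

text \<open>The diagonal entry counts the neighbours, so \<open>x b\<close> can be handed out once
  per neighbour. This difference form involves adjacency alone; the kernel, renumbering and bridge
  arguments rest on it.\<close>

lemma laplacian_apply_eq:
  assumes G: "simple_graph V E" and b: "b \<in> V"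
  shows "laplacian_apply V E x b = (\<Sum>c\<in>V. if {b, c} \<in> E then x b - x c else (0::'r::linordered_idom))"
proof -
  have fin: "finite V"
    using G by (simp add: simple_graph_def)
  have loop: "{b} \<notin> E"
    using simple_graph_edge_subset[OF G, of b b] by auto
  have "laplacian_apply V E x b = of_int (laplacian E b b) * x b
      + (\<Sum>c\<in>V - {b}. of_int (laplacian E b c) * x c)"
    unfolding laplacian_apply_def using fin b by (rule sum.remove)
  also have "(\<Sum>c\<in>V - {b}. of_int (laplacian E b c) * x c)
      = (\<Sum>c\<in>V - {b}. if {b, c} \<in> E then - x c else 0)"
    by (intro sum.cong) (auto simp: laplacian_def)
  also have "\<dots> = (\<Sum>c\<in>V. if {b, c} \<in> E then - x c else 0)"
    using fin loop by (intro sum.mono_neutral_left) auto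
  also have "of_int (laplacian E b b) * x b = (\<Sum>c\<in>V. if {b, c} \<in> E then x b else 0)"
    using fin by (simp add: laplacian_def degree_eq_card_neighbours[OF G] flip: sum.inter_filter)
  finally show ?thesis
    by (simp add: sum.distrib[symmetric]) (intro sum.cong, auto)
qed

lemma laplacian_apply_const:
  assumes "simple_graph V E" "b \<in> V"
  shows "laplacian_apply V E (\<lambda>_. k) b = 0"
  by (auto simp: laplacian_apply_eq[OF assms] intro: sum.neutral)

lemma laplacian_apply_add_const:
  assumes "simple_graph V E" "b \<in> V"
  shows "laplacian_apply V E (\<lambda>c. x c + k) b = laplacian_apply V E x b"
  by (simp add: laplacian_apply_eq[OF assms] cong: if_cong)

text \<open>Rows sum to zero because constants are in the kernel; symmetry carries this over to
  columns.\<close>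

lemma sum_laplacian_column:
  assumes "simple_graph V E" "c \<in> V"
  shows "(\<Sum>b\<in>V. laplacian E b c) = 0"
  using laplacian_apply_const[OF assms, of "1::int"]
  by (simp add: laplacian_apply_def laplacian_sym[of E c])

lemma sum_laplacian_apply:
  assumes "simple_graph V E"
  shows "(\<Sum>b\<in>V. laplacian_apply V E x b) = 0"
proof -
  have "(\<Sum>b\<in>V. laplacian_apply V E x b) = (\<Sum>c\<in>V. of_int (\<Sum>b\<in>V. laplacian E b c) * x c)"
    unfolding laplacian_apply_def by (subst sum.swap) (simp add: sum_distrib_right)
  then show ?thesis
    using sum_laplacian_column[OF assms] by simp
qed

text \<open>Maximum principle: a maximum of \<open>x\<close> propagates along the edges.\<close>

lemma laplacian_kernel_const:
  assumes G: "simple_graph V E" and conn: "connected_graph V E"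
    and ker: "\<And>b. b \<in> V \<Longrightarrow> laplacian_apply V E x b = (0::'r::linordered_idom)"
    and "u \<in> V" "v \<in> V"
  shows "x u = x v"
proof -
  have fin: "finite V" and ne: "V \<noteq> {}"
    using G conn by (simp_all add: simple_graph_def connected_graph_def)
  define M where "M = Max (x ` V)"
  have le: "x b \<le> M" if "b \<in> V" for b
    using that fin by (simp add: M_def)
  obtain w where w: "w \<in> V" "x w = M"
    using Max_in[of "x ` V"] fin ne unfolding M_def by fastforce
  have step: "x c = M" if "x b = M" "{b, c} \<in> E" for b c
  proof -
    have bc: "b \<in> V" "c \<in> V"
      using simple_graph_edge_subset[OF G that(2)] by auto
    have "(\<Sum>c\<in>V. if {b, c} \<in> E then x b - x c else 0) = 0"
      using laplacian_apply_eq[OF G bc(1)] ker[OF bc(1)] by metis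
    \<comment> \<open>At a maximum every summand is nonnegative, so the vanishing sum kills each
      one.\<close>
    then have "\<forall>c\<in>V. (if {b, c} \<in> E then x b - x c else 0) = 0"
      using fin le that(1) by (subst (asm) sum_nonneg_eq_0_iff) auto
    then show ?thesis
      using bc that by force
  qed
  have "x v = M" if "v \<in> V" for v
  proof -
    have "(w, v) \<in> {(x, y). {x, y} \<in> E}\<^sup>*"
      using conn w that by (simp add: connected_graph_def)
    then show ?thesis
      by induction (use w step in auto)
  qed
  then show ?thesis
    using assms by simp
qed

text \<open>Adding the total mass of \<open>x\<close> to every coordinate turns the Laplacian into an injective map.\<close>

lemma laplacian_surj_sum_zero:
  fixes w :: "'a \<Rightarrow> real"
  assumes G: "simple_graph V E" and conn: "connected_graph V E" and w: "sum w V = 0"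
  obtains x :: "'a \<Rightarrow> real" where "\<And>b. b \<in> V \<Longrightarrow> laplacian_apply V E x b = w b"
proof -
  have fin: "finite V" and ne: "V \<noteq> {}"
    using G conn by (simp_all add: simple_graph_def connected_graph_def)
  define S where "S = {x :: 'a \<Rightarrow> real. \<forall>a. a \<notin> V \<longrightarrow> x a = 0}"
  define B :: "('a \<Rightarrow> real) set" where "B = (\<lambda>a b. if b = a then 1 else 0) ` V"
  have S: "span B = S"
    unfolding S_def B_def using fin by (rule span_deltas)
  define T :: "('a \<Rightarrow> real) \<Rightarrow> 'a \<Rightarrow> real"
    where "T x = (\<lambda>b. if b \<in> V then laplacian_apply V E x b + sum x V else 0)" for x
  have lin: "linear T"
    by (rule linearI)
      (auto simp: T_def laplacian_apply_def fun_eq_iff scaleR_fun_def sum.distrib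
        algebra_simps sum_distrib_left)
  \<comment> \<open>The Laplacian part has total \<open>0\<close>, so \<open>T x\<close> determines
    the mass of \<open>x\<close>. If \<open>T x = 0\<close>, the mass is \<open>0\<close>, and
    \<open>x\<close> is in the kernel: a constant on \<open>V\<close> of total
    \<open>0\<close>.\<close>
  have mass: "sum (T x) V = real (card V) * sum x V" for x :: "'a \<Rightarrow> real"
    by (simp add: T_def sum.distrib sum_laplacian_apply[OF G])
  have "x = 0" if x: "x \<in> S" "T x = 0" for x
  proof -
    have s: "sum x V = 0"
      using mass[of x] x(2) fin ne by simp
    have "laplacian_apply V E x b = 0" if "b \<in> V" for b
      using fun_cong[OF x(2), of b] s that by (simp add: T_def)
    then have const: "x u = x v" if "u \<in> V" "v \<in> V" for u v
      using laplacian_kernel_const[OF G conn] that by blast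
    have "x u = 0" if "u \<in> V" for u
    proof -
      have "sum x V = (\<Sum>v\<in>V. x u)"
        by (rule sum.cong[OF refl]) (rule const[OF _ that])
      then show ?thesis
        using s fin ne by simp
    qed
    then show ?thesis
      using x(1) by (auto simp: S_def fun_eq_iff)
  qed
  then have "inj_on T (span B)"
    by (subst linear_inj_on_iff_eq_0[OF lin subspace_span]) (simp add: S)
  moreover have "T ` span B \<subseteq> span B"
    unfolding S by (auto simp: T_def S_def)
  ultimately have "T ` S = S"
    using linear_inj_on_finite_span_surj[OF lin, of B] fin unfolding S by (simp add: B_def)
  moreover have "(\<lambda>b. if b \<in> V then w b else 0) \<in> S"
    by (simp add: S_def)
  ultimately obtain x where x: "(\<lambda>b. if b \<in> V then w b else 0) = T x"
    by blast
  \<comment> \<open>Since \<open>w\<close> has total \<open>0\<close>, its preimage has mass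
    \<open>0\<close> and the extra term in \<open>T\<close> disappears.\<close>
  have "sum (T x) V = sum w V"
    unfolding x[symmetric] by (rule sum.cong) auto
  then have "sum x V = 0"
    using mass[of x] w fin ne by simp
  then have "laplacian_apply V E x b = w b" if "b \<in> V" for b
    using fun_cong[OF x, of b] that by (simp add: T_def)
  then show thesis
    by (rule that)
qed

lemma laplacian_apply_cong:
  assumes "\<And>c. c \<in> V \<Longrightarrow> x c = y c"
  shows "laplacian_apply V E x b = laplacian_apply V E y b"
  unfolding laplacian_apply_def by (rule sum.cong) (simp_all add: assms)

lemma laplacian_apply_diff:
  "laplacian_apply V E (\<lambda>c. x c - y c) b = laplacian_apply V E x b - laplacian_apply V E y b"
  by (simp add: laplacian_apply_def right_diff_distrib sum_subtractf)

lemma laplacian_apply_lincomb: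
  "laplacian_apply V E (\<lambda>c. \<Sum>a\<in>A. u a * f a c) b = (\<Sum>a\<in>A. u a * laplacian_apply V E (f a) b)"
  unfolding laplacian_apply_def
  by (simp add: sum_distrib_left mult.left_commute) (rule sum.swap)

text \<open>Symmetry of the matrix. It lets the barycentric coordinates of a point be read off by
  pairing the point with the dual vertices.\<close>

lemma laplacian_apply_self_adjoint:
  "(\<Sum>b\<in>V. y b * laplacian_apply V E x b) = (\<Sum>b\<in>V. laplacian_apply V E y b * x b)"
  unfolding laplacian_apply_def sum_distrib_left sum_distrib_right
  by (subst sum.swap) (simp add: laplacian_sym mult_ac)

section \<open>The integrality criterion for reflexivity\<close>

text \<open>Normalised to vanish at the last vertex, \<open>x\<close> is the dual vertex for the
  facet opposite \<open>a\<close>; the value \<open>1 - card V\<close> at \<open>a\<close> is forced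
  by total \<open>0\<close>. The vertex set is arbitrary, so that no numbering enters.\<close>

definition integral_potentials :: "'a set \<Rightarrow> 'a set set \<Rightarrow> bool" where
  "integral_potentials V E \<longleftrightarrow> (\<forall>a\<in>V. \<exists>x :: 'a \<Rightarrow> int. \<forall>b\<in>V.
     laplacian_apply V E x b = 1 - (if b = a then int (card V) else 0))"

definition laplacian_row :: "nat \<Rightarrow> nat set set \<Rightarrow> nat \<Rightarrow> nat \<Rightarrow> real" where
  "laplacian_row d E i = (\<lambda>k. if k < d then real_of_int (laplacian E i k) else 0)"

lemma laplacian_simplex_Suc:
  "laplacian_simplex (Suc d) E = convex hull (laplacian_row d E ` {..<Suc d})"
  by (simp add: laplacian_simplex_def laplacian_row_def[abs_def])

text \<open>The deleted column would be multiplied by \<open>x d = 0\<close>, so pairing with a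
  truncated row still gives an entry of the full Laplacian of \<open>x\<close>.\<close>

lemma sum_mult_laplacian_row:
  assumes "x d = 0"
  shows "(\<Sum>k<d. x k * laplacian_row d E b k) = laplacian_apply {..<Suc d} E x b"
  using assms by (simp add: laplacian_apply_def laplacian_row_def mult.commute)

section \<open>Half-spaces and the dual of a Laplacian simplex\<close>

lemma convex_halfspace_fun: "convex {y :: nat \<Rightarrow> real. (\<Sum>k<d. x k * y k) \<le> c}"
proof (rule convexI)
  fix y z :: "nat \<Rightarrow> real" and u v :: real
  assume y: "y \<in> {y. (\<Sum>k<d. x k * y k) \<le> c}" and z: "z \<in> {y. (\<Sum>k<d. x k * y k) \<le> c}"
    and uv: "0 \<le> u" "0 \<le> v" "u + v = 1"
  have "(\<Sum>k<d. x k * (u *\<^sub>R y + v *\<^sub>R z) k) = u * (\<Sum>k<d. x k * y k) + v * (\<Sum>k<d. x k * z k)"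
    by (simp add: scaleR_fun_def algebra_simps sum.distrib sum_distrib_left)
  also have "\<dots> \<le> u * c + v * c"
    using y z uv by (intro add_mono mult_left_mono) auto
  also have "\<dots> = c"
    using uv(3) by (simp flip: distrib_right)
  finally show "u *\<^sub>R y + v *\<^sub>R z \<in> {y. (\<Sum>k<d. x k * y k) \<le> c}"
    by simp
qed

lemma convex_topspace_Euclidean_space: "convex (topspace (Euclidean_space d))"
  by (rule convexI) (simp add: topspace_Euclidean_space scaleR_fun_def)

lemma convex_dual_polytope: "convex (dual_polytope d P)"
proof -
  have eq: "dual_polytope d P =
      topspace (Euclidean_space d) \<inter> (\<Inter>y\<in>P. {x. (\<Sum>k<d. y k * x k) \<le> 1})"
    by (auto simp: dual_polytope_def mult.commute)
  show ?thesis
    unfolding eq by (intro convex_Int convex_INT convex_topspace_Euclidean_space convex_halfspace_fun)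
qed

text \<open>A half-space contains a convex hull as soon as it contains the generators, so only the
  rows need testing.\<close>

lemma mem_dual_laplacian_simplex_iff:
  "x \<in> dual_polytope d (laplacian_simplex (Suc d) E) \<longleftrightarrow>
     x \<in> topspace (Euclidean_space d) \<and> (\<forall>b<Suc d. laplacian_apply {..<Suc d} E x b \<le> 1)"
proof (cases "x \<in> topspace (Euclidean_space d)")
  case True
  then have "x d = 0"
    by (simp add: topspace_Euclidean_space)
  note row = sum_mult_laplacian_row[of x, OF this]
  have "laplacian_simplex (Suc d) E \<subseteq> {y. (\<Sum>k<d. x k * y k) \<le> 1} \<longleftrightarrow>
      laplacian_row d E ` {..<Suc d} \<subseteq> {y. (\<Sum>k<d. x k * y k) \<le> 1}"
    unfolding laplacian_simplex_Suc by (rule subset_hull) (rule convex_halfspace_fun)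
  then show ?thesis
    using True by (auto simp: dual_polytope_def row subset_iff)
qed (simp add: dual_polytope_def)

text \<open>The real potential for \<open>a\<close> lies in the dual, where its pairing with row
  \<open>a\<close> is \<open>- d\<close>. So some lattice generator of the dual has pairing at most
  \<open>- d\<close>, and this forces it to be a potential for \<open>a\<close>.\<close>

lemma reflexive_imp_integral_potentials:
  assumes G: "simple_graph {..<Suc d} E" and conn: "connected_graph {..<Suc d} E"
    and refl: "reflexive_polytope d (laplacian_simplex (Suc d) E)"
  shows "integral_potentials {..<Suc d} E"
  unfolding integral_potentials_def
proof
  fix a
  assume a: "a \<in> {..<Suc d}"
  let ?V = "{..<Suc d}" and ?D = "dual_polytope d (laplacian_simplex (Suc d) E)"
  let ?e = "\<lambda>b. 1 - (if b = a then real (Suc d) else 0)"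
  have e0: "sum ?e ?V = 0"
    using a by (simp add: sum_subtractf del: sum.lessThan_Suc)
  obtain S where S: "finite S" "\<forall>x\<in>S. \<forall>i. x i \<in> \<int>" "?D = convex hull S"
    using refl by (auto simp: reflexive_polytope_def lattice_polytope_def)
  obtain x0 :: "nat \<Rightarrow> real" where x0: "\<And>b. b \<in> ?V \<Longrightarrow> laplacian_apply ?V E x0 b = ?e b"
    using laplacian_surj_sum_zero[OF G conn e0] by blast
  \<comment> \<open>Subtracting the last value moves the solution into dimension \<open>d\<close>
    and leaves its Laplacian unchanged.\<close>
  define x where "x = (\<lambda>k. if k < Suc d then x0 k + (- x0 d) else 0)"
  have x: "laplacian_apply ?V E x b = ?e b" if "b \<in> ?V" for b
  proof -
    have "laplacian_apply ?V E x b = laplacian_apply ?V E (\<lambda>k. x0 k + (- x0 d)) b"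
      by (rule laplacian_apply_cong) (simp add: x_def)
    then show ?thesis
      using laplacian_apply_add_const[OF G that, of x0 "- x0 d"] x0[OF that] by simp
  qed
  have "x \<in> ?D"
    unfolding mem_dual_laplacian_simplex_iff using x
    by (auto simp: topspace_Euclidean_space x_def less_Suc_eq)
  have "S \<noteq> {}"
    using \<open>x \<in> ?D\<close> S(3) by auto
  define g where "g = (\<lambda>y. \<Sum>k<d. y k * laplacian_row d E a k)"
  obtain s where s: "s \<in> S" "\<And>t. t \<in> S \<Longrightarrow> g s \<le> g t"
    using arg_min_if_finite(1)[OF S(1) \<open>S \<noteq> {}\<close>] arg_min_least[OF S(1) \<open>S \<noteq> {}\<close>] by metis
  \<comment> \<open>A linear lower bound on the generators passes to their hull, hence to
    \<open>x\<close>.\<close>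
  have "convex hull S \<subseteq> {y. (\<Sum>k<d. (- laplacian_row d E a k) * y k) \<le> - g s}"
    using s(2)
    by (intro hull_minimal convex_halfspace_fun) (auto simp: g_def mult.commute sum_negf)
  with \<open>x \<in> ?D\<close> have "g s \<le> g x"
    unfolding S(3) by (auto simp: g_def mult.commute sum_negf)
  also have "g x = laplacian_apply ?V E x a"
    unfolding g_def by (rule sum_mult_laplacian_row) (simp add: x_def)
  also have "\<dots> = - real d"
    using x[OF a] by simp
  finally have gs: "g s \<le> - real d" .
  have "s \<in> ?D"
    using s(1) S(3) by (simp add: hull_inc)
  then have sd: "s d = 0" and le: "\<And>b. b \<in> ?V \<Longrightarrow> laplacian_apply ?V E s b \<le> 1"
    unfolding mem_dual_laplacian_simplex_iff by (auto simp: topspace_Euclidean_space)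
  have sa: "laplacian_apply ?V E s a \<le> - real d"
    using gs sum_mult_laplacian_row[of s d E a, OF sd] by (simp add: g_def)
  \<comment> \<open>The entries are at most \<open>1\<close> off \<open>a\<close> and at most
    \<open>- d\<close> at \<open>a\<close>. These bounds add up to \<open>0\<close>, and so do the
    entries; hence all bounds are attained.\<close>
  have sb: "laplacian_apply ?V E s b = ?e b" if "b \<in> ?V" for b
  proof -
    have ge: "0 \<le> ?e b - laplacian_apply ?V E s b" if "b \<in> ?V" for b
      using le[OF that] sa by auto
    have "(\<Sum>b\<in>?V. ?e b - laplacian_apply ?V E s b) = 0"
      using e0 sum_laplacian_apply[OF G, of s] by (simp only: sum_subtractf)
    then show ?thesis
      using ge that by (subst (asm) sum_nonneg_eq_0_iff) auto
  qed
  show "\<exists>x :: nat \<Rightarrow> int. \<forall>b\<in>?V.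
      laplacian_apply ?V E x b = 1 - (if b = a then int (card ?V) else 0)"
  proof (intro exI ballI)
    fix b
    assume b: "b \<in> ?V"
    \<comment> \<open>The coordinates of \<open>s\<close> are integers, so rounding down is harmless
      and the equation can be read over \<open>int\<close>.\<close>
    have fl: "real_of_int \<lfloor>s k\<rfloor> = s k" for k
      using S(2) s(1) by simp
    have "real_of_int (laplacian_apply ?V E (\<lambda>k. \<lfloor>s k\<rfloor>) b) =
        laplacian_apply ?V E (\<lambda>k. real_of_int \<lfloor>s k\<rfloor>) b"
      by (rule laplacian_apply_of_int[symmetric])
    also have "\<dots> = ?e b"
      unfolding fl by (rule sb[OF b])
    also have "\<dots> = real_of_int (1 - (if b = a then int (card ?V) else 0))"
      by simp
    finally show "laplacian_apply ?V E (\<lambda>k. \<lfloor>s k\<rfloor>) b = 1 - (if b = a then int (card ?V) else 0)"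
      by (simp only: of_int_eq_iff)
  qed
qed

text \<open>The normalised potentials \<open>X a\<close> are lattice points. They give the facet
  inequalities of the simplex and generate its dual; both facts come from explicit barycentric
  coordinates.\<close>

lemma integral_potentials_imp_reflexive:
  assumes G: "simple_graph {..<Suc d} E" and conn: "connected_graph {..<Suc d} E"
    and pot: "integral_potentials {..<Suc d} E"
  shows "reflexive_polytope d (laplacian_simplex (Suc d) E)"
proof -
  let ?V = "{..<Suc d}" and ?P = "laplacian_simplex (Suc d) E"
  let ?D = "dual_polytope d ?P" and ?T = "topspace (Euclidean_space d)"
  let ?e = "\<lambda>a b. 1 - (if b = a then real (Suc d) else 0)"
  obtain x0 :: "nat \<Rightarrow> nat \<Rightarrow> int" where x0: "\<And>a b. a \<in> ?V \<Longrightarrow> b \<in> ?V \<Longrightarrow>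
      laplacian_apply ?V E (x0 a) b = 1 - (if b = a then int (card ?V) else 0)"
    using pot unfolding integral_potentials_def by metis
  define X where "X a = (\<lambda>k. if k < d then real_of_int (x0 a k - x0 a d) else 0)" for a
  have Xd: "X a d = 0" for a
    by (simp add: X_def)
  have XT: "X a \<in> ?T" for a
    by (simp add: X_def topspace_Euclidean_space)
  have X: "laplacian_apply ?V E (X a) b = ?e a b" if "a \<in> ?V" "b \<in> ?V" for a b
  proof -
    have "laplacian_apply ?V E (X a) b = laplacian_apply ?V E (\<lambda>k. real_of_int (x0 a k + (- x0 a d))) b"
      by (rule laplacian_apply_cong) (auto simp: X_def less_Suc_eq)
    also have "\<dots> = of_int (laplacian_apply ?V E (x0 a) b)"
      using laplacian_apply_add_const[OF G that(2), of "x0 a" "- x0 a d"]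
      by (simp only: laplacian_apply_of_int)
    finally show ?thesis
      using x0[OF that] by simp
  qed
  \<comment> \<open>For coefficients of total \<open>1\<close> this relates the Laplacian value at
    \<open>b\<close> to the single coefficient \<open>u b\<close>; both halves below solve it for
    \<open>u b\<close>.\<close>
  have comb: "(\<Sum>a\<in>?V. u a * ?e a b) = sum u ?V - real (Suc d) * u b" if "b \<in> ?V" for u b
  proof -
    have "(\<Sum>a\<in>?V. u a * ?e a b) = (\<Sum>a\<in>?V. u a - (if b = a then real (Suc d) * u a else 0))"
      by (intro sum.cong) (auto simp: algebra_simps)
    also have "\<dots> = sum u ?V - real (Suc d) * u b"
      using that by (simp add: sum_subtractf del: sum.lessThan_Suc)
    finally show ?thesis .
  qed
  have "lattice_polytope d ?P"
    unfolding lattice_polytope_def laplacian_simplex_Suc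
    by (intro exI[of _ "laplacian_row d E ` ?V"])
      (auto simp: laplacian_row_def topspace_Euclidean_space)
  moreover have "0 \<in> Euclidean_space d interior_of ?P"
  proof -
    \<comment> \<open>The strict facet inequalities cut out an open neighbourhood of
      \<open>0\<close>, which is then shown to lie in the simplex.\<close>
    define U where "U = {y \<in> ?T. \<forall>a\<in>?V. (\<Sum>k<d. X a k * y k) \<in> {..<1}}"
    have "U = ?T \<inter> (\<Inter>a\<in>?V. {y \<in> ?T. (\<Sum>k<d. X a k * y k) \<in> {..<1}})"
      by (auto simp: U_def)
    moreover have "openin (Euclidean_space d) {y \<in> ?T. (\<Sum>k<d. X a k * y k) \<in> {..<1}}" for a
    proof (rule openin_continuous_map_preimage)
      show "continuous_map (Euclidean_space d) euclideanreal (\<lambda>y. \<Sum>k<d. X a k * y k)"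
        unfolding Euclidean_space_def
        by (intro continuous_map_sum continuous_map_real_mult_left
            continuous_map_from_subtopology continuous_map_product_projection) auto
    qed simp
    ultimately have "openin (Euclidean_space d) U"
      by (auto intro!: openin_Int openin_INT)
    moreover have "0 \<in> U"
      by (simp add: U_def topspace_Euclidean_space)
    moreover have "U \<subseteq> ?P"
    proof
      fix y
      assume y: "y \<in> U"
      \<comment> \<open>The restored last coordinate makes the total \<open>0\<close>, so
        \<open>w\<close> is in the image of the Laplacian.\<close>
      define w where "w = (\<lambda>k. if k < d then y k else - (\<Sum>k<d. y k))"
      have "sum w ?V = 0"
        by (simp add: w_def)
      then obtain u0 :: "nat \<Rightarrow> real" where u0: "\<And>b. b \<in> ?V \<Longrightarrow> laplacian_apply ?V E u0 b = w b"
        using laplacian_surj_sum_zero[OF G conn] by blast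
      \<comment> \<open>The kernel freedom is spent on normalising the total to \<open>1\<close>;
        \<open>u\<close> will be the barycentric coordinates of \<open>y\<close>.\<close>
      define u where "u = (\<lambda>k. u0 k + (1 - sum u0 ?V) / real (Suc d))"
      have u: "laplacian_apply ?V E u b = w b" if "b \<in> ?V" for b
        unfolding u_def using laplacian_apply_add_const[OF G that] u0[OF that] by metis
      have sum_u: "sum u ?V = 1"
        by (simp add: u_def sum.distrib del: sum.lessThan_Suc)
      have u_ge: "0 \<le> u a" if a: "a \<in> ?V" for a
      proof -
        \<comment> \<open>As \<open>X a\<close> vanishes at \<open>d\<close>, the added coordinate
          of \<open>w\<close> does not contribute.\<close>
        have "(\<Sum>k<d. X a k * y k) = (\<Sum>k\<in>?V. X a k * w k)"
          by (simp add: Xd w_def)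
        also have "\<dots> = (\<Sum>k\<in>?V. X a k * laplacian_apply ?V E u k)"
          by (rule sum.cong) (simp_all add: u)
        also have "\<dots> = (\<Sum>k\<in>?V. laplacian_apply ?V E (X a) k * u k)"
          by (rule laplacian_apply_self_adjoint)
        also have "\<dots> = (\<Sum>k\<in>?V. u k * ?e k a)"
          by (rule sum.cong) (auto simp: X[OF a])
        also have "\<dots> = 1 - real (Suc d) * u a"
          using comb[OF a] sum_u by simp
        finally have "(\<Sum>k<d. X a k * y k) = 1 - real (Suc d) * u a" .
        moreover have "(\<Sum>k<d. X a k * y k) < 1"
          using y a by (simp add: U_def)
        ultimately have "0 < real (Suc d) * u a"
          by linarith
        then show ?thesis
          by (simp add: zero_less_mult_iff)
      qed
      have "y = (\<Sum>a\<in>?V. u a *\<^sub>R laplacian_row d E a)"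
      proof
        fix k
        have yk: "y k = 0" if "\<not> k < d"
          using y that by (simp add: U_def topspace_Euclidean_space)
        have "(\<Sum>a\<in>?V. u a *\<^sub>R laplacian_row d E a) k = (\<Sum>a\<in>?V. u a * laplacian_row d E a k)"
          by (simp add: sum_fun_apply scaleR_fun_def)
        also have "\<dots> = (if k < d then laplacian_apply ?V E u k else 0)"
          by (simp add: laplacian_apply_def laplacian_row_def laplacian_sym[of E k] mult.commute
              del: sum.lessThan_Suc)
        also have "\<dots> = y k"
          using u[of k] yk by (auto simp: w_def)
        finally show "y k = (\<Sum>a\<in>?V. u a *\<^sub>R laplacian_row d E a) k" ..
      qed
      also have "\<dots> \<in> ?P"
        unfolding laplacian_simplex_Suc
        by (intro convex_sum convex_convex_hull sum_u u_ge hull_inc) auto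
      finally show "y \<in> ?P" .
    qed
    ultimately show ?thesis
      unfolding interior_of_def by blast
  qed
  moreover have "lattice_polytope d ?D"
  proof -
    have "?D = convex hull (X ` ?V)"
    proof
      show "convex hull (X ` ?V) \<subseteq> ?D"
        by (intro hull_minimal convex_dual_polytope)
          (auto simp: mem_dual_laplacian_simplex_iff XT X simp del: sum.lessThan_Suc)
      show "?D \<subseteq> convex hull (X ` ?V)"
      proof
        fix z
        assume z: "z \<in> ?D"
        then have zT: "z \<in> ?T" and z1: "\<And>b. b \<in> ?V \<Longrightarrow> laplacian_apply ?V E z b \<le> 1"
          by (auto simp: mem_dual_laplacian_simplex_iff)
        \<comment> \<open>These coefficients solve \<open>comb\<close> for the Laplacian of
          \<open>z\<close>; the inequalities defining the dual make them nonnegative.\<close>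
        define u where "u = (\<lambda>b. (1 - laplacian_apply ?V E z b) / real (Suc d))"
        have sum_u: "sum u ?V = 1"
          by (simp add: u_def sum_subtractf sum_laplacian_apply[OF G] del: sum.lessThan_Suc
              flip: sum_divide_distrib)
        define w where "w = (\<lambda>c. \<Sum>a\<in>?V. u a * X a c)"
        have "laplacian_apply ?V E (\<lambda>c. w c - z c) b = 0" if b: "b \<in> ?V" for b
        proof -
          have "laplacian_apply ?V E w b = (\<Sum>a\<in>?V. u a * laplacian_apply ?V E (X a) b)"
            unfolding w_def by (rule laplacian_apply_lincomb)
          also have "\<dots> = (\<Sum>a\<in>?V. u a * ?e a b)"
            by (rule sum.cong) (simp_all add: X[OF _ b])
          also have "\<dots> = laplacian_apply ?V E z b"
            unfolding comb[OF b] sum_u by (simp add: u_def)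
          finally show ?thesis
            by (simp add: laplacian_apply_diff)
        qed
        \<comment> \<open>By the kernel lemma \<open>w\<close> and \<open>z\<close> differ by a
          constant on the vertices; both vanish at \<open>d\<close>, so it is
          \<open>0\<close>.\<close>
        then have const: "w k - z k = w d - z d" if "k \<in> ?V" for k
          using laplacian_kernel_const[OF G conn, of "\<lambda>c. w c - z c" k d] that by simp
        have zero: "w k = 0" "z k = 0" if "d \<le> k" for k
          using that zT by (simp_all add: w_def X_def topspace_Euclidean_space)
        have "w = z"
        proof
          fix k
          show "w k = z k"
            using const[of k] zero[of k] zero[of d] by (cases "k < d") auto
        qed
        moreover have "w = (\<Sum>a\<in>?V. u a *\<^sub>R X a)"
          by (auto simp: w_def fun_eq_iff sum_fun_apply scaleR_fun_def simp del: sum.lessThan_Suc)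
        moreover have "\<dots> \<in> convex hull (X ` ?V)"
          using z1 by (intro convex_sum convex_convex_hull sum_u hull_inc) (auto simp: u_def)
        ultimately show "z \<in> convex hull (X ` ?V)"
          by simp
      qed
    qed
    moreover have "X a k \<in> \<int>" for a k
      by (simp add: X_def)
    ultimately show ?thesis
      unfolding lattice_polytope_def using XT by (intro exI[of _ "X ` ?V"]) auto
  qed
  ultimately show ?thesis
    by (simp add: reflexive_polytope_def)
qed

section \<open>Renumbering and bridges\<close>

text \<open>Injectivity on \<open>V\<close> is enough because every edge lies inside
  \<open>V\<close>.\<close>

lemma insert_in_relabel_iff:
  assumes "simple_graph V E" "inj_on h V" "b \<in> V" "c \<in> V"
  shows "{h b, h c} \<in> relabel h E \<longleftrightarrow> {b, c} \<in> E"
proof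
  assume "{h b, h c} \<in> relabel h E"
  then obtain e where e: "e \<in> E" "h ` {b, c} = h ` e"
    by (auto simp: relabel_def)
  then have "{b, c} = e"
    using assms inj_on_image_eq_iff[OF assms(2), of "{b, c}" e] by (auto simp: simple_graph_def)
  then show "{b, c} \<in> E"
    using e(1) by simp
next
  assume "{b, c} \<in> E"
  then show "{h b, h c} \<in> relabel h E"
    unfolding relabel_def by (rule rev_image_eqI) simp
qed

lemma simple_graph_relabel:
  assumes "simple_graph V E" "inj_on h V"
  shows "simple_graph (h ` V) (relabel h E)"
proof -
  have "card (h ` e) = card e" if "e \<in> E" for e
    using assms that by (intro card_image inj_on_subset[OF assms(2)]) (simp add: simple_graph_def)
  then show ?thesis
    using assms by (auto simp: simple_graph_def relabel_def)
qed

lemma rtrancl_relabel: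
  assumes "(u, v) \<in> {(x, y). {x, y} \<in> E}\<^sup>*"
  shows "(h u, h v) \<in> {(x, y). {x, y} \<in> relabel h E}\<^sup>*"
  using assms
proof induction
  case (step v w)
  then have "{h v, h w} \<in> relabel h E"
    by (auto simp: relabel_def intro!: rev_image_eqI[of "{v, w}"])
  then show ?case
    using step.IH by (simp add: rtrancl_into_rtrancl)
qed simp

lemma connected_graph_relabel:
  assumes "connected_graph V E"
  shows "connected_graph (h ` V) (relabel h E)"
  using assms rtrancl_relabel[of _ _ E h] by (auto simp: connected_graph_def)

text \<open>A potential is transported along the inverse of \<open>h\<close>; the difference form
  sees only adjacency, which \<open>h\<close> preserves.\<close>

lemma integral_potentials_relabel:
  assumes G: "simple_graph V E" and h: "inj_on h V" and pot: "integral_potentials V E"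
  shows "integral_potentials (h ` V) (relabel h E)"
  unfolding integral_potentials_def
proof
  fix a'
  assume "a' \<in> h ` V"
  then obtain a where a: "a \<in> V" "a' = h a"
    by blast
  obtain x :: "_ \<Rightarrow> int" where
    x: "\<And>b. b \<in> V \<Longrightarrow> laplacian_apply V E x b = 1 - (if b = a then int (card V) else 0)"
    using pot a(1) unfolding integral_potentials_def by blast
  let ?x = "\<lambda>c. x (the_inv_into V h c)"
  show "\<exists>x :: _ \<Rightarrow> int. \<forall>b\<in>h ` V. laplacian_apply (h ` V) (relabel h E) x b =
      1 - (if b = a' then int (card (h ` V)) else 0)"
  proof (intro exI ballI)
    fix b'
    assume "b' \<in> h ` V"
    then obtain b where b: "b \<in> V" "b' = h b"
      by blast
    have "laplacian_apply (h ` V) (relabel h E) ?x b' =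
        (\<Sum>c'\<in>h ` V. if {h b, c'} \<in> relabel h E then ?x (h b) - ?x c' else 0)"
      unfolding b(2) using b(1) by (intro laplacian_apply_eq simple_graph_relabel G h imageI)
    also have "\<dots> = (\<Sum>c\<in>V. if {h b, h c} \<in> relabel h E then ?x (h b) - ?x (h c) else 0)"
      by (simp add: sum.reindex[OF h])
    also have "\<dots> = (\<Sum>c\<in>V. if {b, c} \<in> E then x b - x c else 0)"
      using b(1) by (intro sum.cong) (simp_all add: insert_in_relabel_iff[OF G h] the_inv_into_f_f[OF h])
    also have "\<dots> = laplacian_apply V E x b"
      by (rule laplacian_apply_eq[OF G b(1), symmetric])
    also have "\<dots> = 1 - (if b' = a' then int (card (h ` V)) else 0)"
      using x[OF b(1)] h a b by (simp add: card_image inj_on_eq_iff)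
    finally show "laplacian_apply (h ` V) (relabel h E) ?x b' =
        1 - (if b' = a' then int (card (h ` V)) else 0)" .
  qed
qed

section \<open>The Laplacian and the potentials of a bridge\<close>

lemma bridge_eq:
  "bridge E' E'' i j = relabel Inl E' \<union> relabel Inr E'' \<union> {{Inl i, Inr j}}"
  by (simp add: bridge_def relabel_def)

lemma simple_graph_bridge:
  assumes "simple_graph V' E'" "simple_graph V'' E''" "i \<in> V'" "j \<in> V''"
  shows "simple_graph (V' <+> V'') (bridge E' E'' i j)"
  using simple_graph_relabel[OF assms(1), of Inl] simple_graph_relabel[OF assms(2), of Inr] assms(3,4)
  unfolding simple_graph_def bridge_eq Plus_def by (auto simp: finite_image_iff)

lemma connected_graph_bridge:
  assumes "connected_graph V' E'" "connected_graph V'' E''" "i \<in> V'" "j \<in> V''"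
  shows "connected_graph (V' <+> V'') (bridge E' E'' i j)"
proof -
  let ?R = "{(x, y). {x, y} \<in> bridge E' E'' i j}"
  have l: "(Inl u, Inl v) \<in> ?R\<^sup>*" if "u \<in> V'" "v \<in> V'" for u v
  proof -
    have "(u, v) \<in> {(x, y). {x, y} \<in> E'}\<^sup>*"
      using assms(1) that by (simp add: connected_graph_def)
    from rtrancl_relabel[OF this, of Inl] show ?thesis
      by (rule rev_subsetD[OF _ rtrancl_mono]) (auto simp: bridge_eq)
  qed
  have r: "(Inr u, Inr v) \<in> ?R\<^sup>*" if "u \<in> V''" "v \<in> V''" for u v
  proof -
    have "(u, v) \<in> {(x, y). {x, y} \<in> E''}\<^sup>*"
      using assms(2) that by (simp add: connected_graph_def)
    from rtrancl_relabel[OF this, of Inr] show ?thesis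
      by (rule rev_subsetD[OF _ rtrancl_mono]) (auto simp: bridge_eq)
  qed
  have ij: "(Inl i, Inr j) \<in> ?R\<^sup>*" "(Inr j, Inl i) \<in> ?R\<^sup>*"
    by (auto simp: bridge_eq insert_commute)
  have lr: "(Inl u, Inr v) \<in> ?R\<^sup>*" if "u \<in> V'" "v \<in> V''" for u v
    using l[OF that(1) assms(3)] ij(1) r[OF assms(4) that(2)] by (meson rtrancl_trans)
  have rl: "(Inr v, Inl u) \<in> ?R\<^sup>*" if "u \<in> V'" "v \<in> V''" for u v
    using r[OF that(2) assms(4)] ij(2) l[OF assms(3) that(1)] by (meson rtrancl_trans)
  show ?thesis
    unfolding connected_graph_def using assms(3) by (auto simp: l r lr rl)
qed

lemma bridge_edge_iff:
  fixes E' :: "'a set set" and E'' :: "'b set set"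
  shows "{Inl b, Inl c} \<in> bridge E' E'' i j \<longleftrightarrow> {b, c} \<in> E'"
  "{Inr b', Inr c'} \<in> bridge E' E'' i j \<longleftrightarrow> {b', c'} \<in> E''"
  "{Inl b, Inr c'} \<in> bridge E' E'' i j \<longleftrightarrow> b = i \<and> c' = j"
  "{Inr c', Inl b} \<in> bridge E' E'' i j \<longleftrightarrow> b = i \<and> c' = j"
proof -
  have l: "{Inl b, Inl c :: 'a + 'b} \<in> image Inl ` E' \<longleftrightarrow> {b, c} \<in> E'"
    using inj_image_mem_iff[of "image (Inl :: 'a \<Rightarrow> 'a + 'b)" "{b, c}" E']
    by (simp add: inj_def inj_image_eq_iff)
  have r: "{Inr b', Inr c' :: 'a + 'b} \<in> image Inr ` E'' \<longleftrightarrow> {b', c'} \<in> E''"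
    using inj_image_mem_iff[of "image (Inr :: 'b \<Rightarrow> 'a + 'b)" "{b', c'}" E'']
    by (simp add: inj_def inj_image_eq_iff)
  have "{Inl b, Inl c} \<notin> image Inr ` E''" "{Inr b', Inr c'} \<notin> image Inl ` E'"
    by auto
  with l r show "{Inl b, Inl c} \<in> bridge E' E'' i j \<longleftrightarrow> {b, c} \<in> E'"
    and "{Inr b', Inr c'} \<in> bridge E' E'' i j \<longleftrightarrow> {b', c'} \<in> E''"
    by (simp_all add: bridge_def doubleton_eq_iff)
  have "{Inl b, Inr c'} \<notin> image Inl ` E'" "{Inl b, Inr c'} \<notin> image Inr ` E''"
    by auto
  then show lr: "{Inl b, Inr c'} \<in> bridge E' E'' i j \<longleftrightarrow> b = i \<and> c' = j"
    by (simp add: bridge_def doubleton_eq_iff)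
  then show "{Inr c', Inl b} \<in> bridge E' E'' i j \<longleftrightarrow> b = i \<and> c' = j"
    by (simp add: insert_commute)
qed

text \<open>In the difference form the sum splits over the two sides, and the opposite side is
  reached only through the new edge. Hence the correction occurs at its endpoints alone.\<close>

lemma laplacian_apply_bridge:
  assumes G': "simple_graph V' E'" and G'': "simple_graph V'' E''" and i: "i \<in> V'" and j: "j \<in> V''"
  shows "b \<in> V' \<Longrightarrow> laplacian_apply (V' <+> V'') (bridge E' E'' i j) (case_sum x y) (Inl b) =
      laplacian_apply V' E' x b + (if b = i then x i - y j else 0)"
    and "c \<in> V'' \<Longrightarrow> laplacian_apply (V' <+> V'') (bridge E' E'' i j) (case_sum x y) (Inr c) =
      laplacian_apply V'' E'' y c + (if c = j then y j - x i else 0)"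
proof -
  have fin: "finite V'" "finite V''"
    using G' G'' by (simp_all add: simple_graph_def)
  note B = laplacian_apply_eq[OF simple_graph_bridge[OF assms]]
  show "laplacian_apply (V' <+> V'') (bridge E' E'' i j) (case_sum x y) (Inl b) =
      laplacian_apply V' E' x b + (if b = i then x i - y j else 0)" if b: "b \<in> V'"
  proof -
    have "(\<Sum>c\<in>V''. if b = i \<and> c = j then x b - y c else 0) = (if b = i then x i - y j else 0)"
      using fin j by auto
    then show ?thesis
      using b by (simp add: B[OF InlI[OF b]] sum.Plus[OF fin] bridge_edge_iff laplacian_apply_eq[OF G'] cong: if_cong)
  qed
  show "laplacian_apply (V' <+> V'') (bridge E' E'' i j) (case_sum x y) (Inr c) =
      laplacian_apply V'' E'' y c + (if c = j then y j - x i else 0)" if c: "c \<in> V''"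
  proof -
    have "(\<Sum>b\<in>V'. if b = i \<and> c = j then y c - x b else 0) = (if c = j then y j - x i else 0)"
      using fin i by auto
    then show ?thesis
      using c by (simp add: B[OF InrI[OF c]] sum.Plus[OF fin] bridge_edge_iff laplacian_apply_eq[OF G''] cong: if_cong)
  qed
qed

text \<open>The combination of \<open>p\<close> and \<open>q\<close> has Laplacian
  \<open>1 - 2 n\<close> at \<open>a\<close> and an excess \<open>n\<close> at \<open>i\<close>,
  superposed if \<open>a = i\<close>. The new edge cancels this excess and the deficit
  \<open>n\<close> of \<open>r\<close> at \<open>j\<close>.\<close>

lemma bridge_potential:
  fixes V' :: "'a set" and V'' :: "'b set"
  assumes G': "simple_graph V' E'" and G'': "simple_graph V'' E''"
    and pot': "integral_potentials V' E'" and pot'': "integral_potentials V'' E''"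
    and card: "card V' = n" "card V'' = n"
    and i: "i \<in> V'" and j: "j \<in> V''" and a: "a \<in> V'"
  obtains x :: "'a \<Rightarrow> int" and y :: "'b \<Rightarrow> int" where
    "\<And>b. b \<in> V' \<Longrightarrow> laplacian_apply V' E' x b + (if b = i then x i - y j else 0) =
      1 - (if b = a then 2 * int n else 0)"
    and "\<And>c. c \<in> V'' \<Longrightarrow> laplacian_apply V'' E'' y c + (if c = j then y j - x i else 0) = 1"
proof -
  obtain p :: "'a \<Rightarrow> int" where
    p: "\<And>b. b \<in> V' \<Longrightarrow> laplacian_apply V' E' p b = 1 - (if b = a then int n else 0)"
    using pot' a card(1) unfolding integral_potentials_def by blast
  obtain q :: "'a \<Rightarrow> int" where
    q: "\<And>b. b \<in> V' \<Longrightarrow> laplacian_apply V' E' q b = 1 - (if b = i then int n else 0)"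
    using pot' i card(1) unfolding integral_potentials_def by blast
  obtain r :: "'b \<Rightarrow> int" where
    r: "\<And>c. c \<in> V'' \<Longrightarrow> laplacian_apply V'' E'' r c = 1 - (if c = j then int n else 0)"
    using pot'' j card(2) unfolding integral_potentials_def by blast
  \<comment> \<open>This is \<open>2 p - q\<close>, written with differences only so that
    \<open>laplacian_apply_diff\<close> applies.\<close>
  define x where "x = (\<lambda>b. p b - (q b - p b))"
  \<comment> \<open>The jump \<open>n\<close> across the edge is forced: summing the second equation
    over \<open>V''\<close> leaves \<open>y j - x i = card V''\<close>. A translation of
    \<open>r\<close> achieves it.\<close>
  define y where "y = (\<lambda>c. r c + (x i + int n - r j))"
  have y: "laplacian_apply V'' E'' y c = 1 - (if c = j then int n else 0)" if "c \<in> V''" for c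
    unfolding y_def
    using laplacian_apply_add_const[OF G'' that, of r "x i + int n - r j"] r[OF that] by (rule trans)
  have x: "laplacian_apply V' E' x b = 1 - (if b = a then 2 * int n else 0) + (if b = i then int n else 0)"
    if "b \<in> V'" for b
    unfolding x_def laplacian_apply_diff using p[OF that] q[OF that] by simp
  have yx: "y j - x i = int n"
    by (simp add: y_def)
  show thesis
    by (rule that[of x y]) (use x y yx in auto)
qed

lemma integral_potentials_bridge:
  assumes G': "simple_graph V' E'" and G'': "simple_graph V'' E''"
    and pot': "integral_potentials V' E'" and pot'': "integral_potentials V'' E''"
    and card: "card V' = card V''"
    and i: "i \<in> V'" and j: "j \<in> V''"
  shows "integral_potentials (V' <+> V'') (bridge E' E'' i j)"
  unfolding integral_potentials_def
proof
  let ?B = "bridge E' E'' i j" and ?n = "card V'"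
  fix a
  assume a: "a \<in> V' <+> V''"
  have fin: "finite V'" "finite V''"
    using G' G'' by (simp_all add: simple_graph_def)
  have cardV: "card (V' <+> V'') = 2 * ?n"
    using fin card by (simp add: card_Plus)
  note L = laplacian_apply_bridge[OF G' G'' i j]
  show "\<exists>z :: _ \<Rightarrow> int. \<forall>b\<in>V' <+> V''.
      laplacian_apply (V' <+> V'') ?B z b = 1 - (if b = a then int (card (V' <+> V'')) else 0)"
  proof (cases a)
    case (Inl a')
    then have "a' \<in> V'"
      using a by auto
    from bridge_potential[OF G' G'' pot' pot'' refl card[symmetric] i j this] obtain x y where
      "\<And>b. b \<in> V' \<Longrightarrow> laplacian_apply V' E' x b + (if b = i then x i - y j else 0) =
        1 - (if b = a' then 2 * int ?n else 0)"
      "\<And>c. c \<in> V'' \<Longrightarrow> laplacian_apply V'' E'' y c + (if c = j then y j - x i else 0) = 1"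
      by blast
    note xy = this
    show ?thesis
    proof (intro exI ballI)
      fix b
      assume "b \<in> V' <+> V''"
      then show "laplacian_apply (V' <+> V'') ?B (case_sum x y) b =
          1 - (if b = a then int (card (V' <+> V'')) else 0)"
        by (rule PlusE) (simp_all only: L xy cardV Inl sum.inject sum.distinct if_False
            of_nat_mult of_nat_numeral diff_0_right)
    qed
  next
    case (Inr a')
    then have "a' \<in> V''"
      using a by auto
    \<comment> \<open>The bridge is symmetric, so the same construction applies with the two graphs
      exchanged; the potential on the second graph comes first.\<close>
    from bridge_potential[OF G'' G' pot'' pot' card[symmetric] refl j i this] obtain y x where
      "\<And>c. c \<in> V'' \<Longrightarrow> laplacian_apply V'' E'' y c + (if c = j then y j - x i else 0) =
        1 - (if c = a' then 2 * int ?n else 0)"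
      "\<And>b. b \<in> V' \<Longrightarrow> laplacian_apply V' E' x b + (if b = i then x i - y j else 0) = 1"
      by blast
    note xy = this
    show ?thesis
    proof (intro exI ballI)
      fix b
      assume "b \<in> V' <+> V''"
      then show "laplacian_apply (V' <+> V'') ?B (case_sum x y) b =
          1 - (if b = a then int (card (V' <+> V'')) else 0)"
        by (rule PlusE) (simp_all only: L xy cardV Inr sum.inject sum.distinct if_False
            of_nat_mult of_nat_numeral diff_0_right)
    qed
  qed
qed

theorem theorem3p32:
  fixes n :: nat and E' E'' :: "nat set set" and i j :: nat and h :: "nat + nat \<Rightarrow> nat"
  assumes "simple_graph {..<n} E'" and "connected_graph {..<n} E'"
    and "simple_graph {..<n} E''" and "connected_graph {..<n} E''"
    and "reflexive_polytope (n - 1) (laplacian_simplex n E')"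
    and "reflexive_polytope (n - 1) (laplacian_simplex n E'')"
    and "i \<in> {..<n}" and "j \<in> {..<n}"
    and "bij_betw h ({..<n} <+> {..<n}) {..<2 * n}"
  shows "reflexive_polytope (2 * n - 1)
           (laplacian_simplex (2 * n) (relabel h (bridge E' E'' i j)))"
proof -
  let ?V = "{..<n} <+> {..<n}" and ?B = "bridge E' E'' i j"
  have inj: "inj_on h ?V" and img: "h ` ?V = {..<2 * n}"
    using assms(9) by (auto simp: bij_betw_def)
  \<comment> \<open>The endpoint \<open>i\<close> makes \<open>n\<close> positive, so the criteria
    stated for \<open>Suc d\<close> vertices apply with \<open>d = n - 1\<close> and
    \<open>d = 2 * n - 1\<close>.\<close>
  have n: "n = Suc (n - 1)" and n2: "2 * n = Suc (2 * n - 1)"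
    using assms(7) by auto
  note pot = reflexive_imp_integral_potentials[of "n - 1", folded n]
  note reflexive = integral_potentials_imp_reflexive[of "2 * n - 1", folded n2]
  have G: "simple_graph ?V ?B"
    using assms by (intro simple_graph_bridge)
  have "integral_potentials ?V ?B"
    using assms by (intro integral_potentials_bridge pot) auto
  then have "integral_potentials {..<2 * n} (relabel h ?B)"
    using integral_potentials_relabel[OF G inj] img by simp
  moreover have "simple_graph {..<2 * n} (relabel h ?B)"
    using simple_graph_relabel[OF G inj] img by simp
  moreover have "connected_graph {..<2 * n} (relabel h ?B)"
    using connected_graph_relabel[OF connected_graph_bridge[OF assms(2,4,7,8)], of h] img by simp
  ultimately show ?thesis
    by (intro reflexive)
qed

end
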